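(* Let $X=Y=\{0,1,2,3,4\}^{\mathbb Z}$ be the full $5$-shift with the shift map $\sigma$, and let $\pi:X\to Y$ be defined by $\pi(x)_i=x_{i+1}+x_i \pmod 5$ for $i\in\mathbb Z$. Let $P=\{x\in X:x_0=0\}$. Let $\mu$ be an ergodic $\sigma$-invariant Borel probability measure on $X$ such that $\mathbb{2}$ is not a factor of $\mu$ and $\mu(P)>\frac12$. Then $\pi\mu$ has exactly three ergodic lifts on $X$, i.e. there are exactly three ergodic $\sigma$-invariant Borel probability measures $\mu'$ on $X$ with $\pi\mu'=\pi\mu$.
   Context: $(\sigma x)_i=x_{i+1}$. $\pi\mu=\mu\circ\pi^{-1}$ is the pushforward. $\mathbb{2}$ denotes the unique ergodic measure preserving system consisting of two atoms (two points of mass $\frac12$ each, interchanged by the transformation). "$\mathbb{2}$ is a factor of $\mu$" means that $\mathbb{2}$ is a measure-theoretic factor of the measure preserving system $(X,\sigma,\mu)$ (i.e. there is an a.e. defined measurable map from $X$ to the two-point space that a.e. intertwines the transformations and pushes $\mu$ to the uniform measure). *)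

theory Defs
  imports "HOL-Probability.Probability"
begin

subsection \<open>Measure preserving systems\<close>

definition measure_preserving_system :: "'a measure \<Rightarrow> ('a \<Rightarrow> 'a) \<Rightarrow> bool" where
  "measure_preserving_system M T \<longleftrightarrow>
     prob_space M \<and> T \<in> measurable M M \<and> distr M M T = M"

definition ergodic_system :: "'a measure \<Rightarrow> ('a \<Rightarrow> 'a) \<Rightarrow> bool" where
  "ergodic_system M T \<longleftrightarrow> measure_preserving_system M T \<and>
     (\<forall>A\<in>sets M. T -` A \<inter> space M = A \<longrightarrow> measure M A = 0 \<or> measure M A = 1)"

text \<open>The factor map is a total function: a measurable map defined only almost everywhere
  extends by a constant to the null set where it is undefined.\<close>

definition is_factor :: "'b measure \<Rightarrow> ('b \<Rightarrow> 'b) \<Rightarrow> 'a measure \<Rightarrow> ('a \<Rightarrow> 'a) \<Rightarrow> bool" where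
  "is_factor N S M T \<longleftrightarrow>
     (\<exists>f\<in>measurable M N. distr M N f = N \<and> (AE x in M. f (T x) = S (f x)))"

text \<open>The ergodic system on two atoms of mass one half is realized on the type \<^typ>\<open>bool\<close>,
  with the map \<^const>\<open>Not\<close> interchanging the two points.\<close>

definition two_atoms :: "bool measure" where
  "two_atoms = uniform_count_measure UNIV"

subsection \<open>The full 5-shift\<close>

text \<open>The alphabet \<open>{0,1,2,3,4}\<close> is the numeral type \<^typ>\<open>5\<close>, the ring of integers modulo 5;
  in particular its addition is addition modulo 5. The full shift is the whole type
  \<open>int \<Rightarrow> 5\<close>.\<close>

definition shift_borel :: "(int \<Rightarrow> 5) measure" where
  "shift_borel = sigma UNIV
     {U. openin (product_topology (\<lambda>_::int. discrete_topology (UNIV :: 5 set)) UNIV) U}"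

definition shift_map :: "(int \<Rightarrow> 5) \<Rightarrow> (int \<Rightarrow> 5)" where
  "shift_map x = (\<lambda>i. x (i + 1))"

definition sum_code :: "(int \<Rightarrow> 5) \<Rightarrow> (int \<Rightarrow> 5)" where
  "sum_code x = (\<lambda>i. x (i + 1) + x i)"

definition ergodic_shift_measure :: "(int \<Rightarrow> 5) measure \<Rightarrow> bool" where
  "ergodic_shift_measure \<mu> \<longleftrightarrow> sets \<mu> = sets shift_borel \<and> ergodic_system \<mu> shift_map"

end

theory Submission
  imports Defs
begin

text \<open>The fibre of \<^const>\<open>sum_code\<close> through \<open>x\<close> consists of the five translates
  \<open>R\<^sub>c x = (x\<^sub>i + (-1)\<^sup>i c)\<^sub>i\<close>, and \<open>\<sigma> R\<^sub>c = R\<^sub>-\<^sub>c \<sigma>\<close>. Hence each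
  \<open>m\<^sub>c = (R\<^sub>c \<mu> + R\<^sub>-\<^sub>c \<mu>) / 2\<close> is an invariant lift of \<open>\<pi>\<mu>\<close>. If \<open>A\<close> is invariant then
  \<open>\<sigma>\<close> interchanges \<open>R\<^sub>c\<^sup>-\<^sup>1 A\<close> and \<open>R\<^sub>-\<^sub>c\<^sup>-\<^sup>1 A\<close>, so an invariant set of intermediate \<open>m\<^sub>c\<close>-measure
  would yield a factor of \<open>\<mu>\<close> on two atoms; thus \<open>m\<^sub>c\<close> is ergodic. The condition \<open>\<mu>(P) > 1/2\<close>
  separates \<open>m\<^sub>0 = \<mu>\<close>, \<open>m\<^sub>1\<close> and \<open>m\<^sub>2\<close>. The average of a lift over the five translations depends
  only on its image under \<open>\<pi>\<close>; therefore an ergodic lift is not singular to all of the \<open>m\<^sub>c\<close>,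
  and so it equals one of them.\<close>

subsection \<open>Distinct ergodic measures are mutually singular\<close>

lemma measure_preserving_systemD:
  assumes "measure_preserving_system M T"
  shows "prob_space M" "T \<in> measurable M M" "distr M M T = M"
  using assms by (auto simp: measure_preserving_system_def)

lemma measure_vimage_preserving:
  assumes "measure_preserving_system M T" "A \<in> sets M"
  shows "measure M (T -` A \<inter> space M) = measure M A"
  using measure_distr[of T M M A] measure_preserving_systemD[OF assms(1)] assms(2) by simp

text \<open>The maximizers of \<open>M - N\<close> are closed under preimages, countable unions and decreasing
  limits, so the limes superior of the preimages of a Hahn set is a strictly invariant one.\<close>

lemma invariant_maximizer:
  assumes M: "measure_preserving_system M T" and N: "measure_preserving_system N T"
    and sets_eq: "sets N = sets M"
  shows "\<exists>A\<in>sets M. T -` A \<inter> space M = A \<and>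
    (\<forall>X\<in>sets M. measure M X - measure N X \<le> measure M A - measure N A)"
proof -
  note space_eq = sets_eq_imp_space_eq[OF sets_eq]
  interpret M: prob_space M using M by (rule measure_preserving_systemD)
  interpret N: prob_space N using N by (rule measure_preserving_systemD)
  note [measurable] = measure_preserving_systemD(2)[OF M]
  define d where "d X = measure M X - measure N X" for X
  obtain Y where Y [measurable]: "Y \<in> sets M"
    and le: "\<And>X. X \<in> sets M \<Longrightarrow> X \<subseteq> Y \<Longrightarrow> emeasure N X \<le> emeasure M X"
    and ge: "\<And>X. X \<in> sets M \<Longrightarrow> X \<inter> Y = {} \<Longrightarrow> emeasure M X \<le> emeasure N X"
    using finite_unsigned_Hahn_decomposition[OF M.finite_measure_axioms N.finite_measure_axioms sets_eq]
    by metis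
  have split: "d X = d (X \<inter> Z) + d (X - Z)" if "X \<in> sets M" "Z \<in> sets M" for X Z
    using M.finite_measure_Diff'[of X Z] N.finite_measure_Diff'[of X Z] that
    by (simp add: d_def sets_eq)
  \<comment> \<open>Exchanging \<open>X\<close> for \<open>Y\<close> discards \<open>X - Y\<close>,
    where \<open>d\<close> is at most 0, and adds \<open>Y - X\<close>, where \<open>d\<close> is at
    least 0.\<close>
  have max: "d X \<le> d Y" if [measurable]: "X \<in> sets M" for X
  proof -
    have "d (Y - X) \<ge> 0"
      using le[of "Y - X"] by (simp add: d_def M.emeasure_eq_measure N.emeasure_eq_measure)
    moreover have "d (X - Y) \<le> 0"
      using ge[of "X - Y"] by (simp add: d_def M.emeasure_eq_measure N.emeasure_eq_measure Diff_Int_distrib2)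
    ultimately show ?thesis
      using split[of X Y] split[of Y X] by (simp add: Int_commute)
  qed
  have d_vimage: "d (T -` X \<inter> space M) = d X" if "X \<in> sets M" for X
    using measure_vimage_preserving[OF M that] measure_vimage_preserving[OF N, of X] that
    by (simp add: d_def space_eq sets_eq)
  \<comment> \<open>\<open>d\<close> is modular: the values at the union and at the intersection add
    up to twice the maximum, and neither exceeds it.\<close>
  have d_Un: "d (A \<union> B) = d Y" if "A \<in> sets M" "B \<in> sets M" "d A = d Y" "d B = d Y" for A B
  proof -
    have "d (A \<union> B) + d (A \<inter> B) = d A + d B"
      using split[of "A \<union> B" B] split[of A B] that by (simp add: Un_Diff Int_absorb1)
    then show ?thesis
      using that max[of "A \<union> B"] max[of "A \<inter> B"] by auto
  qed
  define V where "V n = ((\<lambda>X. T -` X \<inter> space M) ^^ n) Y" for n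
  have V_Suc: "V (Suc n) = T -` V n \<inter> space M" for n
    by (simp add: V_def)
  have V [measurable]: "V n \<in> sets M" for n
    by (induction n) (simp_all add: V_Suc, simp add: V_def)
  have d_V: "d (V n) = d Y" for n
    by (induction n) (simp_all add: V_Suc d_vimage, simp add: V_def)
  have d_finite: "d (\<Union>k\<le>m. V (n + k)) = d Y" for m n
    by (induction m) (simp_all add: d_V atMost_Suc d_Un)
  define B where "B n = (\<Union>k. V (n + k))" for n
  have B [measurable]: "B n \<in> sets M" for n
    unfolding B_def by measurable
  have d_B: "d (B n) = d Y" for n
  proof -
    have B_eq: "B n = (\<Union>m. \<Union>k\<le>m. V (n + k))"
      by (auto simp: B_def)
    have "incseq (\<lambda>m. \<Union>k\<le>m. V (n + k))"
      by (intro monoI UN_mono) auto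
    then have "(\<lambda>m. d (\<Union>k\<le>m. V (n + k))) \<longlonglongrightarrow> d (B n)"
      unfolding d_def B_eq
      by (intro tendsto_diff M.finite_Lim_measure_incseq N.finite_Lim_measure_incseq)
         (auto simp: sets_eq)
    then show ?thesis
      by (simp add: d_finite LIMSEQ_const_iff)
  qed
  have "decseq B"
    unfolding decseq_Suc_iff B_def by (auto, metis add_Suc_right)
  then have "(\<lambda>n. d (B n)) \<longlonglongrightarrow> d (\<Inter>n. B n)"
    unfolding d_def
    by (intro tendsto_diff M.finite_Lim_measure_decseq N.finite_Lim_measure_decseq)
       (auto simp: sets_eq)
  then have d_Inter: "d (\<Inter>n. B n) = d Y"
    by (simp add: d_B LIMSEQ_const_iff)
  have B_Suc: "T -` B n \<inter> space M = B (Suc n)" for n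
    by (auto simp: B_def V_Suc)
  \<comment> \<open>Preimages only shift the index of a decreasing sequence. The limit is therefore
    invariant as a set, not just up to null sets, as \<open>ergodic_system\<close> demands of the
    sets it tests.\<close>
  have "T -` (\<Inter>n. B n) \<inter> space M = (\<Inter>n. B (Suc n))"
    by (auto simp: B_Suc[symmetric])
  also have "\<dots> = (\<Inter>n. B n)"
    using \<open>decseq B\<close> by (auto simp: decseq_Suc_iff)
  finally show ?thesis
    using d_Inter max by (intro bexI[of _ "\<Inter>n. B n"]) (auto simp: d_def)
qed

text \<open>If the measures differ, the invariant maximizer of \<open>M - N\<close> has positive
  value there. Ergodicity allows each measure only the values 0 and 1 on it, so they are 1 and
  0.\<close>

lemma ergodic_systems_eq_or_singular:
  assumes M: "ergodic_system M T" and N: "ergodic_system N T"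
    and sets_eq: "sets N = sets M" and "M \<noteq> N"
  shows "\<exists>A\<in>sets M. T -` A \<inter> space M = A \<and> measure M A = 1 \<and> measure N A = 0"
proof -
  note space_eq = sets_eq_imp_space_eq[OF sets_eq]
  have M': "measure_preserving_system M T" and N': "measure_preserving_system N T"
    using M N by (auto simp: ergodic_system_def)
  interpret M: prob_space M using M' by (rule measure_preserving_systemD)
  interpret N: prob_space N using N' by (rule measure_preserving_systemD)
  obtain A where A: "A \<in> sets M" "T -` A \<inter> space M = A"
    and max: "\<And>X. X \<in> sets M \<Longrightarrow> measure M X - measure N X \<le> measure M A - measure N A"
    using invariant_maximizer[OF M' N' sets_eq] by blast
  obtain X where X: "X \<in> sets M" "measure M X \<noteq> measure N X"
    using \<open>M \<noteq> N\<close> measure_eqI[of M N]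
    by (auto simp: sets_eq M.emeasure_eq_measure N.emeasure_eq_measure)
  \<comment> \<open>Passing from \<open>X\<close> to its complement reverses the sign of the
    difference, so one of the two makes it positive.\<close>
  have "measure M A - measure N A > 0"
    using max[OF X(1)] max[of "space M - X"] X M.prob_compl[of X] N.prob_compl[of X]
    by (simp add: sets_eq space_eq)
  moreover have "measure M A = 0 \<or> measure M A = 1" "measure N A = 0 \<or> measure N A = 1"
    using M N A by (auto simp: ergodic_system_def sets_eq space_eq)
  ultimately show ?thesis
    using A by (intro bexI[of _ A]) auto
qed

subsection \<open>The Borel sets of the shift space\<close>

lemma space_shift_borel [simp]: "space shift_borel = UNIV"
  by (simp add: shift_borel_def space_measure_of_conv)

lemma sets_shift_borel: "sets shift_borel =
    sigma_sets UNIV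
      {U. openin (product_topology (\<lambda>_::int. discrete_topology (UNIV :: 5 set)) UNIV) U}"
  by (simp add: shift_borel_def)

lemma measurable_shift_borel_coordinate [measurable]:
  "(\<lambda>x. x i) \<in> measurable shift_borel (count_space UNIV)"
proof (rule measurableI)
  fix A :: "5 set"
  have "openin (product_topology (\<lambda>_::int. discrete_topology (UNIV :: 5 set)) UNIV) {x. x i \<in> A}"
    using openin_continuous_map_preimage[OF continuous_map_product_coordinates[of i UNIV "\<lambda>_. discrete_topology (UNIV::5 set)"], of A]
    by simp
  then show "(\<lambda>x. x i) -` A \<inter> space shift_borel \<in> sets shift_borel"
    by (auto simp: sets_shift_borel vimage_def)
qed auto

text \<open>An open set is the union of the central cylinders it contains, and there are only
  countably many of these. The product form allows measurability to be checked coordinate by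
  coordinate.\<close>

lemma sets_shift_borel_eq_PiM: "sets shift_borel = sets (PiM UNIV (\<lambda>_. count_space UNIV))"
proof
  show "sets (PiM UNIV (\<lambda>_. count_space UNIV)) \<subseteq> sets shift_borel"
  proof -
    have "(\<lambda>x. x) \<in> measurable shift_borel (PiM UNIV (\<lambda>_::int. count_space (UNIV::5 set)))"
      by (rule measurable_PiM_single') auto
    then show ?thesis
      by (auto dest: measurable_sets)
  qed
next
  let ?P = "PiM UNIV (\<lambda>_::int. count_space (UNIV::5 set))"
  \<comment> \<open>Indexing by window radius and word makes the index type countable; a word of the
    wrong length gives the empty cylinder.\<close>
  define cyl :: "nat \<times> 5 list \<Rightarrow> (int \<Rightarrow> 5) set"
    where "cyl = (\<lambda>(n, l). {x. map x [-int n..int n] = l})"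
  have cyl_sets: "cyl p \<in> sets ?P" for p
  proof -
    obtain n l where p: "p = (n, l)" by fastforce
    show ?thesis
    proof (cases "\<exists>w. map w [-int n..int n] = l")
      case True
      then obtain w where w: "map w [-int n..int n] = l" by blast
      have "cyl p = {x\<in>space ?P. \<forall>i\<in>{-int n..int n}. x i = w i}"
        by (auto simp: cyl_def p w[symmetric] space_PiM)
      also have "\<dots> \<in> sets ?P"
        by measurable
      finally show ?thesis .
    next
      case False
      then show ?thesis by (auto simp: cyl_def p)
    qed
  qed
  have "U \<in> sets ?P"
    if U: "openin (product_topology (\<lambda>_::int. discrete_topology (UNIV :: 5 set)) UNIV) U" for U
  proof -
    have "\<exists>p. x \<in> cyl p \<and> cyl p \<subseteq> U" if "x \<in> U" for x
    proof -
      obtain W :: "int \<Rightarrow> 5 set" where W: "finite {i. W i \<noteq> UNIV}" "x \<in> Pi\<^sub>E UNIV W" "Pi\<^sub>E UNIV W \<subseteq> U"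
        using U \<open>x \<in> U\<close> unfolding openin_product_topology_alt by auto
      \<comment> \<open>All restricted coordinates of the basic open set lie in the window of radius
        \<open>n\<close>; the inserted 0 covers the case that there are none.\<close>
      define n where "n = nat (Max (insert 0 (abs ` {i. W i \<noteq> UNIV})))"
      have n: "\<bar>i\<bar> \<le> int n" if "W i \<noteq> UNIV" for i
        using W(1) that by (auto simp: n_def intro!: Max_ge)
      have "cyl (n, map x [-int n..int n]) \<subseteq> Pi\<^sub>E UNIV W"
      proof
        fix y assume "y \<in> cyl (n, map x [-int n..int n])"
        then have y: "y i = x i" if "\<bar>i\<bar> \<le> int n" for i
          using that by (auto simp: cyl_def abs_le_iff)
        have "y i \<in> W i" for i
          using n[of i] y[of i] W(2) by (cases "W i = UNIV") (auto simp: PiE_iff)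
        then show "y \<in> Pi\<^sub>E UNIV W" by auto
      qed
      then show ?thesis
        using W(3) by (intro exI[of _ "(n, map x [-int n..int n])"]) (auto simp: cyl_def)
    qed
    then have "U = (\<Union>p\<in>{p. cyl p \<subseteq> U}. cyl p)"
      by blast
    also have "\<dots> \<in> sets ?P"
      using cyl_sets by (intro sets.countable_UN') auto
    finally show ?thesis .
  qed
  moreover have "space ?P = UNIV" by (simp add: space_PiM)
  ultimately show "sets shift_borel \<subseteq> sets ?P"
    unfolding sets_shift_borel using sets.sigma_sets_subset[of _ ?P] by (metis (no_types, lifting) mem_Collect_eq subsetI)
qed

lemma measurable_shift_borelI:
  assumes "\<And>i. (\<lambda>x. f x i) \<in> measurable M (count_space UNIV)"
  shows "f \<in> measurable M shift_borel"
proof -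
  have "(\<lambda>x i. f x i) \<in> measurable M (PiM UNIV (\<lambda>_. count_space UNIV))"
    using assms by (intro measurable_PiM_single') auto
  then show ?thesis
    by (simp add: measurable_cong_sets[OF refl sets_shift_borel_eq_PiM])
qed

lemma measurable_shift_map [measurable]: "shift_map \<in> measurable shift_borel shift_borel"
  by (rule measurable_shift_borelI) (simp add: shift_map_def)

lemma measurable_sum_code [measurable]: "sum_code \<in> measurable shift_borel shift_borel"
  by (rule measurable_shift_borelI) (simp add: sum_code_def)

subsection \<open>Translations along the fibres\<close>

definition translate :: "5 \<Rightarrow> (int \<Rightarrow> 5) \<Rightarrow> (int \<Rightarrow> 5)" where
  "translate c x = (\<lambda>i. if even i then x i + c else x i - c)"

lemma measurable_translate [measurable]: "translate c \<in> measurable shift_borel shift_borel"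
  by (rule measurable_shift_borelI) (simp add: translate_def)

lemma translate_0 [simp]: "translate 0 x = x"
  by (simp add: translate_def fun_eq_iff)

lemma translate_translate: "translate c (translate d x) = translate (c + d) x"
  by (auto simp: translate_def fun_eq_iff algebra_simps)

text \<open>The shift changes the parity of every index and thereby the sign with which
  \<open>c\<close> is added.\<close>

lemma translate_shift_map: "translate c (shift_map x) = shift_map (translate (- c) x)"
  by (auto simp: translate_def shift_map_def fun_eq_iff)

lemma sum_code_translate [simp]: "sum_code (translate c x) = sum_code x"
  by (auto simp: translate_def sum_code_def fun_eq_iff)

section \<open>A Borel section of the code\<close>

primrec section_pos :: "(int \<Rightarrow> 5) \<Rightarrow> nat \<Rightarrow> 5" where
  "section_pos y 0 = 0"
| "section_pos y (Suc n) = y (int n) - section_pos y n"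

primrec section_neg :: "(int \<Rightarrow> 5) \<Rightarrow> nat \<Rightarrow> 5" where
  "section_neg y 0 = 0"
| "section_neg y (Suc n) = y (- int (Suc n)) - section_neg y n"

text \<open>The preimage of \<open>y\<close> with symbol 0 at coordinate 0, found by solving
  \<open>y i = x (i + 1) + x i\<close> forwards and backwards from there.\<close>

definition fibre_section :: "(int \<Rightarrow> 5) \<Rightarrow> (int \<Rightarrow> 5)" where
  "fibre_section y = (\<lambda>i. if i \<ge> 0 then section_pos y (nat i) else section_neg y (nat (- i)))"

lemma measurable_fibre_section [measurable]: "fibre_section \<in> measurable shift_borel shift_borel"
proof (rule measurable_shift_borelI)
  fix i
  have [measurable]: "(\<lambda>y. section_pos y n) \<in> measurable shift_borel (count_space UNIV)" for n
    by (induction n) simp_all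
  have [measurable]: "(\<lambda>y. section_neg y n) \<in> measurable shift_borel (count_space UNIV)" for n
    by (induction n) simp_all
  show "(\<lambda>y. fibre_section y i) \<in> measurable shift_borel (count_space UNIV)"
    unfolding fibre_section_def by measurable
qed

lemma fibre_section_sum_code: "fibre_section (sum_code x) = translate (- x 0) x"
proof
  fix i
  have pos: "section_pos (sum_code x) n = translate (- x 0) x (int n)" for n
    by (induction n) (auto simp: translate_def sum_code_def algebra_simps)
  have neg: "section_neg (sum_code x) n = translate (- x 0) x (- int n)" for n
    by (induction n) (auto simp: translate_def sum_code_def algebra_simps)
  show "fibre_section (sum_code x) i = translate (- x 0) x i"
    by (auto simp: fibre_section_def pos neg)
qed

text \<open>The right-hand side sees \<open>M\<close> only through its image under
  \<open>sum_code\<close>, so two lifts of one measure give the same sum. Summing over all of the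
  group makes the choice of base point in each fibre irrelevant.\<close>

lemma sum_emeasure_translate:
  assumes M: "sets M = sets shift_borel" and A [measurable]: "A \<in> sets shift_borel"
  shows "(\<Sum>c\<in>UNIV. emeasure M (translate c -` A)) =
    (\<integral>\<^sup>+y. (\<Sum>c\<in>UNIV. indicator A (translate c (fibre_section y))) \<partial>distr M shift_borel sum_code)"
proof -
  note [measurable_cong] = M
  have space: "space M = UNIV"
    using sets_eq_imp_space_eq[OF M] by simp
  have fibre: "(\<Sum>c\<in>UNIV. indicator A (translate c (fibre_section (sum_code x)))) =
    (\<Sum>c\<in>UNIV. indicator A (translate c x) :: ennreal)" for x
    unfolding fibre_section_sum_code translate_translate
    by (rule sum.reindex_bij_witness[where i = "\<lambda>c. c + x 0" and j = "\<lambda>c. c - x 0"]) auto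
  have "(\<Sum>c\<in>UNIV. emeasure M (translate c -` A)) =
      (\<Sum>c\<in>UNIV. \<integral>\<^sup>+x. indicator A (translate c x) \<partial>M)"
  proof (rule sum.cong)
    fix c
    have "translate c -` A \<in> sets M"
      using measurable_sets[OF measurable_translate A, of c] by (simp add: M)
    then show "emeasure M (translate c -` A) = (\<integral>\<^sup>+x. indicator A (translate c x) \<partial>M)"
      by (simp flip: nn_integral_indicator add: indicator_def)
  qed simp
  also have "\<dots> = (\<integral>\<^sup>+x. (\<Sum>c\<in>UNIV. indicator A (translate c x)) \<partial>M)"
    by (rule nn_integral_sum[symmetric]) measurable
  also have "\<dots> = (\<integral>\<^sup>+x. (\<Sum>c\<in>UNIV. indicator A (translate c (fibre_section (sum_code x)))) \<partial>M)"
    by (simp add: fibre)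
  also have "\<dots> = (\<integral>\<^sup>+y. (\<Sum>c\<in>UNIV. indicator A (translate c (fibre_section y))) \<partial>distr M shift_borel sum_code)"
    by (subst nn_integral_distr) measurable
  finally show ?thesis .
qed

subsection \<open>The symmetrized translates\<close>

text \<open>The measure \<open>m_c\<close> of the outline: the average of the images of
  \<open>M\<close> under \<open>translate c\<close> and \<open>translate (- c)\<close>, given by its
  values on Borel sets.\<close>

definition sym_translate :: "(int \<Rightarrow> 5) measure \<Rightarrow> 5 \<Rightarrow> (int \<Rightarrow> 5) measure" where
  "sym_translate M c = measure_of UNIV (sets shift_borel)
     (\<lambda>A. (emeasure M (translate c -` A) + emeasure M (translate (- c) -` A)) / 2)"

lemma sets_sym_translate [simp, measurable_cong]: "sets (sym_translate M c) = sets shift_borel"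
  using sets.sigma_sets_eq[of shift_borel] sets.space_closed[of shift_borel]
  by (simp add: sym_translate_def sets_measure_of)

lemma space_sym_translate [simp]: "space (sym_translate M c) = UNIV"
  using sets_eq_imp_space_eq[OF sets_sym_translate] by simp

lemma vimage_translate_sets [measurable]:
  "A \<in> sets shift_borel \<Longrightarrow> translate c -` A \<in> sets shift_borel"
  using measurable_sets[OF measurable_translate, of A c] by simp

lemma emeasure_sym_translate:
  assumes M: "sets M = sets shift_borel" and A: "A \<in> sets shift_borel"
  shows "emeasure (sym_translate M c) A =
    (emeasure M (translate c -` A) + emeasure M (translate (- c) -` A)) / 2"
  unfolding sym_translate_def
proof (rule emeasure_measure_of_sigma)
  show "sigma_algebra UNIV (sets shift_borel)"
    using sets.sigma_algebra_axioms[of shift_borel] by simp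
  show "positive (sets shift_borel)
     (\<lambda>A. (emeasure M (translate c -` A) + emeasure M (translate (- c) -` A)) / 2)"
    by (simp add: positive_def)
  show "countably_additive (sets shift_borel)
     (\<lambda>A. (emeasure M (translate c -` A) + emeasure M (translate (- c) -` A)) / 2)"
  proof (rule countably_additiveI)
    fix A :: "nat \<Rightarrow> (int \<Rightarrow> 5) set"
    assume A: "range A \<subseteq> sets shift_borel" "disjoint_family A"
    have "(\<Sum>n. emeasure M (translate d -` A n)) = emeasure M (translate d -` (\<Union>n. A n))" for d
      unfolding vimage_UN using A
      by (intro suminf_emeasure) (auto simp: M disjoint_family_on_def vimage_translate_sets)
    then show "(\<Sum>n. (emeasure M (translate c -` A n) + emeasure M (translate (- c) -` A n)) / 2) =
      (emeasure M (translate c -` (\<Union>n. A n)) + emeasure M (translate (- c) -` (\<Union>n. A n))) / 2"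
      by (simp flip: suminf_add add: divide_ennreal_def)
  qed
qed (rule A)

lemma sym_translate_0:
  assumes "sets M = sets shift_borel"
  shows "sym_translate M 0 = M"
proof (rule measure_eqI)
  fix A assume "A \<in> sets (sym_translate M 0)"
  then show "emeasure (sym_translate M 0) A = emeasure M A"
    using assms by (simp add: emeasure_sym_translate vimage_def ennreal_divide_times
      ennreal_mult_divide_eq flip: mult_2 mult.commute[of _ 2])
qed (simp add: assms)

lemma sym_translate_uminus: "sym_translate M (- c) = sym_translate M c"
  by (simp add: sym_translate_def add.commute)

lemma measure_sym_translate:
  assumes "prob_space M" "sets M = sets shift_borel" "A \<in> sets shift_borel"
  shows "measure (sym_translate M c) A =
    (measure M (translate c -` A) + measure M (translate (- c) -` A)) / 2"
proof -
  interpret prob_space M by fact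
  have "emeasure (sym_translate M c) A =
    ennreal ((measure M (translate c -` A) + measure M (translate (- c) -` A)) / 2)"
    using assms by (simp add: emeasure_sym_translate emeasure_eq_measure flip: ennreal_plus)
      (simp flip: divide_ennreal)
  then show ?thesis
    by (simp add: measure_def)
qed

lemma measure_preserving_sym_translate:
  assumes sets: "sets M = sets shift_borel" and M: "measure_preserving_system M shift_map"
  shows "measure_preserving_system (sym_translate M c) shift_map"
  unfolding measure_preserving_system_def
proof (intro conjI)
  interpret prob_space M using M by (rule measure_preserving_systemD)
  have space: "space M = UNIV"
    using sets_eq_imp_space_eq[OF sets] by simp
  have "emeasure (sym_translate M c) UNIV = (1 + 1) / 2"
    using sets.top[of shift_borel] emeasure_space_1 by (simp add: emeasure_sym_translate sets space)
  then show "prob_space (sym_translate M c)"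
    by (intro prob_spaceI) simp
  show "shift_map \<in> measurable (sym_translate M c) (sym_translate M c)"
    by measurable
  show "distr (sym_translate M c) (sym_translate M c) shift_map = sym_translate M c"
  proof (rule measure_eqI)
    fix A assume "A \<in> sets (distr (sym_translate M c) (sym_translate M c) shift_map)"
    then have A [measurable]: "A \<in> sets shift_borel" by simp
    have TA: "shift_map -` A \<in> sets shift_borel"
      using measurable_sets[OF measurable_shift_map A] by simp
    \<comment> \<open>Invariance of \<open>M\<close> and the sign change under the shift exchange
      the two summands of the average.\<close>
    have swap: "emeasure M (translate d -` (shift_map -` A)) = emeasure M (translate (- d) -` A)" for d
    proof -
      have "emeasure M (translate (- d) -` A) = emeasure (distr M M shift_map) (translate (- d) -` A)"
        using M by (simp add: measure_preserving_systemD)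
      also have "\<dots> = emeasure M (shift_map -` (translate (- d) -` A))"
        using measure_preserving_systemD(2)[OF M]
        by (subst emeasure_distr) (simp_all add: sets space vimage_translate_sets)
      also have "shift_map -` (translate (- d) -` A) = translate d -` (shift_map -` A)"
        by (auto simp: translate_shift_map)
      finally show ?thesis by simp
    qed
    show "emeasure (distr (sym_translate M c) (sym_translate M c) shift_map) A = emeasure (sym_translate M c) A"
      using TA by (subst emeasure_distr)
        (simp_all add: emeasure_sym_translate sets swap[of c] swap[of "- c", simplified] add.commute)
  qed simp
qed

lemma distr_sym_translate:
  assumes sets: "sets M = sets shift_borel"
  shows "distr (sym_translate M c) shift_borel sum_code = distr M shift_borel sum_code"
proof (rule measure_eqI)
  note [measurable_cong] = sets
  fix A assume "A \<in> sets (distr (sym_translate M c) shift_borel sum_code)"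
  then have A [measurable]: "A \<in> sets shift_borel" by simp
  have space: "space M = UNIV"
    using sets_eq_imp_space_eq[OF sets] by simp
  have SA: "sum_code -` A \<in> sets shift_borel"
    using measurable_sets[OF measurable_sum_code A] by simp
  have "emeasure (distr (sym_translate M c) shift_borel sum_code) A = emeasure (sym_translate M c) (sum_code -` A)"
    by (subst emeasure_distr) simp_all
  \<comment> \<open>The preimage of \<open>A\<close> is a union of fibres, which all translations
    preserve, so \<open>c\<close> may be replaced by 0.\<close>
  also have "\<dots> = emeasure (sym_translate M 0) (sum_code -` A)"
    using SA by (simp add: emeasure_sym_translate sets vimage_def)
  also have "\<dots> = emeasure (distr M shift_borel sum_code) A"
    by (subst emeasure_distr) (simp_all add: sym_translate_0 sets space)
  finally show "emeasure (distr (sym_translate M c) shift_borel sum_code) A =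
    emeasure (distr M shift_borel sum_code) A" .
qed simp

text \<open>Up to null sets the preimage of \<open>B\<close> is its complement, so membership in
  \<open>B\<close> is a map onto two points that alternates along orbits.\<close>

lemma two_atoms_factorI:
  assumes M: "measure_preserving_system M T" and B: "B \<in> sets M"
    and null: "measure M ((T -` B \<inter> space M) \<inter> B) = 0" and full: "measure M ((T -` B \<inter> space M) \<union> B) = 1"
  shows "is_factor two_atoms Not M T"
proof -
  interpret prob_space M using M by (rule measure_preserving_systemD)
  let ?C = "T -` B \<inter> space M"
  have C: "?C \<in> sets M"
    using measure_preserving_systemD(2)[OF M] B by (rule measurable_sets)
  \<comment> \<open>\<open>B\<close> and its preimage have equal measure and split the space almost
    everywhere.\<close>
  have half: "measure M B = 1 / 2"
    using finite_measure_Union'[OF C B] finite_measure_Diff'[OF B C] null full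
      measure_vimage_preserving[OF M B] by (simp add: Int_commute)
  have meas: "(\<lambda>x. x \<in> B) \<in> measurable M two_atoms"
    using B by (simp add: two_atoms_def measurable_cong_sets[OF refl sets_uniform_count_measure_count_space])
  have "distr M two_atoms (\<lambda>x. x \<in> B) = two_atoms"
  proof (rule measure_eqI_finite[where A = UNIV])
    fix b :: bool
    have "emeasure (distr M two_atoms (\<lambda>x. x \<in> B)) {b} = emeasure M ({x. (x \<in> B) = b} \<inter> space M)"
      using meas by (subst emeasure_distr) (auto simp: two_atoms_def vimage_def)
    also have "{x. (x \<in> B) = b} \<inter> space M = (if b then B else space M - B)"
      using sets.sets_into_space[OF B] by auto
    also have "emeasure M \<dots> = ennreal (1 / 2)"
      using half prob_compl[OF B] by (simp add: emeasure_eq_measure del: ennreal_half)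
    also have "\<dots> = emeasure two_atoms {b}"
      by (simp add: two_atoms_def emeasure_uniform_count_measure)
    finally show "emeasure (distr M two_atoms (\<lambda>x. x \<in> B)) {b} = emeasure two_atoms {b}" .
  qed (auto simp: two_atoms_def sets_uniform_count_measure)
  moreover have "AE x in M. (T x \<in> B) = (\<not> x \<in> B)"
  proof -
    have "AE x in M. x \<notin> ?C \<inter> B"
      using null B C by (intro AE_not_in) (simp add: null_sets_def emeasure_eq_measure)
    moreover have "AE x in M. x \<in> ?C \<union> B"
      using full B C by (simp add: prob_eq_1)
    ultimately show ?thesis
      using AE_space by eventually_elim auto
  qed
  ultimately show ?thesis
    using meas by (auto simp: is_factor_def)
qed

lemma ergodic_sym_translate:
  assumes erg: "ergodic_shift_measure M" and nf: "\<not> is_factor two_atoms Not M shift_map"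
  shows "ergodic_shift_measure (sym_translate M c)"
proof -
  have sets: "sets M = sets shift_borel" and M: "ergodic_system M shift_map"
    using erg by (auto simp: ergodic_shift_measure_def)
  have pres: "measure_preserving_system M shift_map"
    using M by (simp add: ergodic_system_def)
  interpret prob_space M using pres by (rule measure_preserving_systemD)
  have space: "space M = UNIV"
    using sets_eq_imp_space_eq[OF sets] by simp
  have "measure (sym_translate M c) A = 0 \<or> measure (sym_translate M c) A = 1"
    if A: "A \<in> sets shift_borel" and inv: "shift_map -` A = A" for A
  proof -
    let ?B = "translate c -` A" and ?C = "translate (- c) -` A"
    have B: "?B \<in> sets M" and C: "?C \<in> sets M"
      using A by (simp_all add: sets vimage_translate_sets)
    have inv': "shift_map x \<in> A \<longleftrightarrow> x \<in> A" for x
      using inv by auto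
    \<comment> \<open>For invariant \<open>A\<close> the shift interchanges its two translates, so
      their intersection and union are invariant although each need not be.\<close>
    have BC: "shift_map -` ?B = ?C" and CB: "shift_map -` ?C = ?B"
      by (auto simp: translate_shift_map inv')
    have zero_one: "measure M X = 0 \<or> measure M X = 1" if "X \<in> sets M" "shift_map -` X = X" for X
      using M that by (simp add: ergodic_system_def space)
    have "shift_map -` (?B \<inter> ?C) = ?B \<inter> ?C"
      unfolding vimage_Int BC CB by (rule Int_commute)
    then have "measure M (?B \<inter> ?C) = 0 \<or> measure M (?B \<inter> ?C) = 1"
      by (rule zero_one[OF sets.Int[OF B C]])
    moreover have "shift_map -` (?B \<union> ?C) = ?B \<union> ?C"
      unfolding vimage_Un BC CB by (rule Un_commute)
    then have "measure M (?B \<union> ?C) = 0 \<or> measure M (?B \<union> ?C) = 1"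
      by (rule zero_one[OF sets.Un[OF B C]])
    \<comment> \<open>A null intersection with a full union would make membership in
      \<open>?B\<close> a factor map onto two atoms.\<close>
    moreover have "measure M (?B \<union> ?C) \<noteq> 1" if "measure M (?B \<inter> ?C) = 0"
      using two_atoms_factorI[OF pres B, unfolded BC space Int_UNIV_right] nf that
      by (metis Un_commute Int_commute)
    ultimately consider "measure M (?B \<inter> ?C) = 1" | "measure M (?B \<union> ?C) = 0"
      by blast
    then show ?thesis
    proof cases
      case 1
      then have "measure M ?B = 1" "measure M ?C = 1"
        using finite_measure_mono[of "?B \<inter> ?C" ?B] finite_measure_mono[of "?B \<inter> ?C" ?C] B C
          prob_le_1[of ?B] prob_le_1[of ?C] by (auto intro!: antisym)
      then show ?thesis
        by (simp add: measure_sym_translate[OF prob_space_axioms sets A])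
    next
      case 2
      then have "measure M ?B = 0" "measure M ?C = 0"
        using finite_measure_mono[of ?B "?B \<union> ?C"] finite_measure_mono[of ?C "?B \<union> ?C"] B C
        by (auto simp: measure_le_0_iff)
      then show ?thesis
        by (simp add: measure_sym_translate[OF prob_space_axioms sets A])
    qed
  qed
  then show ?thesis
    using measure_preserving_sym_translate[OF sets pres]
    by (auto simp: ergodic_shift_measure_def ergodic_system_def)
qed

subsection \<open>Counting the lifts\<close>

text \<open>Otherwise \<open>N\<close> is singular to every \<open>sym_translate M c\<close>. A
  single set then has full \<open>N\<close>-measure while all its translates are
  \<open>M\<close>-null, contradicting the equality of the translate sums of two lifts.\<close>

lemma ergodic_lift_is_sym_translate:
  assumes erg: "ergodic_shift_measure M" and nf: "\<not> is_factor two_atoms Not M shift_map"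
    and N: "ergodic_shift_measure N"
    and lift: "distr N shift_borel sum_code = distr M shift_borel sum_code"
  shows "\<exists>c. N = sym_translate M c"
proof (rule ccontr)
  assume "\<not> ?thesis"
  then have neq: "N \<noteq> sym_translate M c" for c by blast
  have sets_M: "sets M = sets shift_borel" and sets_N: "sets N = sets shift_borel"
    using erg N by (auto simp: ergodic_shift_measure_def)
  interpret M: prob_space M
    using erg by (auto simp: ergodic_shift_measure_def ergodic_system_def measure_preserving_system_def)
  interpret N: prob_space N
    using N by (auto simp: ergodic_shift_measure_def ergodic_system_def measure_preserving_system_def)
  have "\<exists>A\<in>sets N. measure N A = 1 \<and> measure (sym_translate M c) A = 0" for c
    using ergodic_systems_eq_or_singular[of N shift_map "sym_translate M c"] N neq
      ergodic_sym_translate[OF erg nf, of c]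
    by (auto simp: ergodic_shift_measure_def)
  then obtain A where A: "\<And>c. A c \<in> sets N" "\<And>c. measure N (A c) = 1"
    "\<And>c. measure (sym_translate M c) (A c) = 0"
    by metis
  \<comment> \<open>One set that serves all five values of \<open>c\<close> at once.\<close>
  define E where "E = (\<Inter>c. A c)"
  have E: "E \<in> sets shift_borel"
    using A(1) unfolding E_def sets_N[symmetric] by (intro sets.countable_INT') auto
  have "AE x in N. x \<in> A c" for c
    using A(1,2) by (simp add: N.prob_eq_1)
  then have "AE x in N. x \<in> E"
    by (simp add: E_def AE_all_countable)
  then have N_E: "measure N E = 1"
    using E by (simp add: N.prob_eq_1 sets_N)
  have "measure M (translate c -` E) = 0" for c
  proof -
    have "measure M (translate c -` E) \<le> measure M (translate c -` A c)"
      using A(1) by (intro M.finite_measure_mono) (auto simp: E_def sets_M sets_N vimage_translate_sets)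
    also have "\<dots> = 0"
      using A(3)[of c] measure_nonneg[of M "translate c -` A c"] measure_nonneg[of M "translate (- c) -` A c"] A(1)
      by (simp add: measure_sym_translate[OF M.prob_space_axioms sets_M] sets_N add_nonneg_eq_0_iff)
    finally show ?thesis
      by (simp add: measure_le_0_iff)
  qed
  then have "(\<Sum>c\<in>UNIV. emeasure N (translate c -` E)) = 0"
    using sum_emeasure_translate[OF sets_M E] sum_emeasure_translate[OF sets_N E] lift
    by (simp add: M.emeasure_eq_measure)
  \<comment> \<open>A vanishing sum of nonnegative terms has a vanishing term at
    \<open>c = 0\<close>, which is the measure of \<open>E\<close> itself.\<close>
  then have "emeasure N (translate 0 -` E) = 0"
    by (simp del: translate_0)
  then show False
    using N_E by (simp add: N.emeasure_eq_measure vimage_def)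
qed

text \<open>Each \<open>sym_translate M e\<close> gives more than half of its mass to the points
  with symbol \<open>e\<close> or \<open>- e\<close> at 0. For \<open>c\<close> and \<open>d\<close>
  these sets are disjoint, so one probability measure cannot favour both.\<close>

lemma sym_translate_neq:
  assumes M: "prob_space M" and sets: "sets M = sets shift_borel"
    and half: "measure M {x. x 0 = 0} > 1 / 2"
    and disj: "c \<noteq> d" "c \<noteq> - d"
  shows "sym_translate M c \<noteq> sym_translate M d"
proof
  interpret M: prob_space M by fact
  define Q :: "5 \<Rightarrow> (int \<Rightarrow> 5) set" where "Q e = {x. x 0 \<in> {e, - e}}" for e
  have Q: "Q e \<in> sets shift_borel" for e
    using measurable_sets[OF measurable_shift_borel_coordinate, of "{e, - e}" 0] by (simp add: Q_def vimage_def)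
  have large: "measure (sym_translate M e) (Q e) > 1 / 2" for e
  proof -
    have "measure M (translate a -` Q e) > 1 / 2" if "a \<in> {e, - e}" for a
    proof -
      \<comment> \<open>Coordinate 0 is even, so translation by \<open>a\<close> turns the symbol 0
        there into \<open>a\<close>.\<close>
      have "{x. x 0 = 0} \<subseteq> translate a -` Q e"
        using that by (auto simp: Q_def translate_def)
      then have "measure M {x. x 0 = 0} \<le> measure M (translate a -` Q e)"
        using Q by (intro M.finite_measure_mono) (auto simp: sets vimage_translate_sets)
      then show ?thesis using half by simp
    qed
    from this[of e] this[of "- e"] show ?thesis
      by (simp add: measure_sym_translate[OF M sets Q])
  qed
  assume eq: "sym_translate M c = sym_translate M d"
  have "measure (sym_translate M d) (Q c \<union> Q d) =
      measure (sym_translate M d) (Q c) + measure (sym_translate M d) (Q d)"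
  proof (rule measure_Union)
    show "Q c \<inter> Q d = {}"
      using disj by (auto simp: Q_def)
  qed (use Q in \<open>auto simp: emeasure_sym_translate sets M.emeasure_eq_measure ennreal_divide_eq_top_iff\<close>)
  moreover have "measure (sym_translate M d) (Q c \<union> Q d) \<le> 1"
    unfolding measure_sym_translate[OF M sets sets.Un[OF Q Q]]
    using add_mono[OF M.prob_le_1 M.prob_le_1] by simp
  ultimately show False
    using large[of c] large[of d] eq by simp
qed

theorem theorem6p6:
  fixes \<mu> :: "(int \<Rightarrow> 5) measure"
  assumes "ergodic_shift_measure \<mu>"
    and "\<not> is_factor two_atoms Not \<mu> shift_map"
    and "measure \<mu> {x. x 0 = 0} > 1 / 2"
  shows "card {\<mu>'. ergodic_shift_measure \<mu>' \<and>
           distr \<mu>' shift_borel sum_code = distr \<mu> shift_borel sum_code} = 3"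
proof -
  have sets: "sets \<mu> = sets shift_borel" and prob: "prob_space \<mu>"
    using assms(1)
    by (auto simp: ergodic_shift_measure_def ergodic_system_def measure_preserving_system_def)
  let ?m = "sym_translate \<mu>"
  \<comment> \<open>Listed so that the classes under negation, \<open>{0}\<close>,
    \<open>{1, - 1}\<close> and \<open>{2, - 2}\<close>, are visible; each yields one
    measure.\<close>
  have UNIV_5: "(UNIV :: 5 set) = {0, 1, 2, - 1, - 2}"
    by (rule sym, rule card_subset_eq) simp_all
  have "{\<mu>'. ergodic_shift_measure \<mu>' \<and>
      distr \<mu>' shift_borel sum_code = distr \<mu> shift_borel sum_code} = range ?m"
    using ergodic_lift_is_sym_translate[OF assms(1,2)] ergodic_sym_translate[OF assms(1,2)]
      distr_sym_translate[OF sets] by auto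
  also have "\<dots> = {?m 0, ?m 1, ?m 2}"
    by (auto simp: UNIV_5 sym_translate_uminus)
  also have "card \<dots> = 3"
    using sym_translate_neq[OF prob sets assms(3)] by simp
  finally show ?thesis .
qed

end
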